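(* Let $\alpha:I\to\mathbb{E}^3$ be a regular curve and let $\gamma$ be its RM mate, i.e., a curve whose unit tangent $\mathbf{t}_\gamma$ is a rotation minimizing vector field along $\alpha$. Then: (i) $\alpha$ is a spherical curve if and only if $\gamma$ is a Bertrand curve; (ii) $\alpha$ is a plane curve if and only if $\gamma$ is a generalized helix.
   Context: $\mathbb{E}^3$ is $\mathbb{R}^3$ with the standard Euclidean inner product, $I\subset\mathbb{R}$ is an interval, and $\alpha$ is parameterized by arc-length. A rotation minimizing (RM) frame along $\alpha$ is an orthonormal frame $\{\mathbf{t},\mathbf{n}_1,\mathbf{n}_2\}$ with $\mathbf{t}=\alpha'$ satisfying $\mathbf{t}'=\kappa_1\mathbf{n}_1+\kappa_2\mathbf{n}_2$ and $\mathbf{n}_i'=-\kappa_i\mathbf{t}$ ($i=1,2$) for some functions $\kappa_1,\kappa_2$; the fields $\mathbf{n}_i$ are called RM vector fields along $\alpha$. If $\mathbf{t}_\gamma=\mathbf{n}_1$, then $\{\mathbf{n}_1,-\mathbf{t},\mathbf{n}_2\}$ is taken as the Frenet frame of the RM mate $\gamma$, with curvature $\kappa_\gamma=\kappa_1$ and torsion $\tau_\gamma=-\kappa_2$. A curve is spherical (respectively, plane) if it lies on some sphere (respectively, plane) of $\mathbb{E}^3$. A curve is a Bertrand curve if there exists another curve having the same principal normal. A generalized (or general) helix is a curve whose tangent makes a constant angle with a fixed direction; equivalently, the ratio of its torsion to its curvature is constant.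
   Formalization: The curvature κ_1 of γ is assumed nowhere zero; (i) is claimed only if κ_1 is constant whenever κ_2 is (otherwise (i) is false); a Bertrand mate must share the principal normal lines, and may have singular points or zero curvature. *)

theory Defs
  imports "HOL-Analysis.Analysis"
begin

definition orthonormal3 :: "real^3 \<Rightarrow> real^3 \<Rightarrow> real^3 \<Rightarrow> bool" where
  "orthonormal3 a b c \<longleftrightarrow>
     norm a = 1 \<and> norm b = 1 \<and> norm c = 1 \<and> a \<bullet> b = 0 \<and> a \<bullet> c = 0 \<and> b \<bullet> c = 0"

text \<open>The first derivative condition together with \<open>norm (t s) = 1\<close> says that \<open>\<alpha>\<close> is parameterized
  by arc-length. At end points of \<open>I\<close> the derivatives are one-sided.\<close>

definition rm_frame ::
  "real set \<Rightarrow> (real \<Rightarrow> real^3) \<Rightarrow> (real \<Rightarrow> real^3) \<Rightarrow> (real \<Rightarrow> real^3) \<Rightarrow> (real \<Rightarrow> real^3) \<Rightarrow>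
   (real \<Rightarrow> real) \<Rightarrow> (real \<Rightarrow> real) \<Rightarrow> bool" where
  "rm_frame I \<alpha> t n1 n2 \<kappa>1 \<kappa>2 \<longleftrightarrow>
     (\<forall>s\<in>I. orthonormal3 (t s) (n1 s) (n2 s) \<and>
       (\<alpha> has_vector_derivative t s) (at s within I) \<and>
       (t has_vector_derivative \<kappa>1 s *\<^sub>R n1 s + \<kappa>2 s *\<^sub>R n2 s) (at s within I) \<and>
       (n1 has_vector_derivative - (\<kappa>1 s *\<^sub>R t s)) (at s within I) \<and>
       (n2 has_vector_derivative - (\<kappa>2 s *\<^sub>R t s)) (at s within I))"

text \<open>Frenet equations in an arbitrary parameter: \<open>v\<close> is the (signed) speed, \<open>k\<close> and \<open>l\<close> are curvature
  and torsion multiplied by \<open>v\<close>. As for the frame \<open>{n1, -t, n2}\<close> of an RM mate, the curvature may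
  have either sign. The speed is allowed to vanish, so a parameterized curve may carry a
  Frenet frame through its singular points.\<close>

definition frenet_frame_speed ::
  "real set \<Rightarrow> (real \<Rightarrow> real^3) \<Rightarrow> (real \<Rightarrow> real) \<Rightarrow> (real \<Rightarrow> real^3) \<Rightarrow> (real \<Rightarrow> real^3) \<Rightarrow>
   (real \<Rightarrow> real^3) \<Rightarrow> (real \<Rightarrow> real) \<Rightarrow> (real \<Rightarrow> real) \<Rightarrow> bool" where
  "frenet_frame_speed I c v T N B k l \<longleftrightarrow>
     (\<forall>s\<in>I. orthonormal3 (T s) (N s) (B s) \<and>
       (c has_vector_derivative v s *\<^sub>R T s) (at s within I) \<and>
       (T has_vector_derivative k s *\<^sub>R N s) (at s within I) \<and>
       (N has_vector_derivative - (k s *\<^sub>R T s) + l s *\<^sub>R B s) (at s within I) \<and>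
       (B has_vector_derivative - (l s *\<^sub>R N s)) (at s within I))"

abbreviation frenet_frame ::
  "real set \<Rightarrow> (real \<Rightarrow> real^3) \<Rightarrow> (real \<Rightarrow> real^3) \<Rightarrow> (real \<Rightarrow> real^3) \<Rightarrow> (real \<Rightarrow> real^3) \<Rightarrow>
   (real \<Rightarrow> real) \<Rightarrow> (real \<Rightarrow> real) \<Rightarrow> bool" where
  "frenet_frame I c T N B \<kappa> \<tau> \<equiv> frenet_frame_speed I c (\<lambda>s. 1) T N B \<kappa> \<tau>"

definition normal_line :: "(real \<Rightarrow> real^3) \<Rightarrow> (real \<Rightarrow> real^3) \<Rightarrow> real \<Rightarrow> (real^3) set" where
  "normal_line c N s = range (\<lambda>r. c s + r *\<^sub>R N s)"

definition spherical_curve :: "real set \<Rightarrow> (real \<Rightarrow> real^3) \<Rightarrow> bool" where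
  "spherical_curve I c \<longleftrightarrow> (\<exists>p r. 0 < r \<and> c ` I \<subseteq> sphere p r)"

definition plane_curve :: "real set \<Rightarrow> (real \<Rightarrow> real^3) \<Rightarrow> bool" where
  "plane_curve I c \<longleftrightarrow> (\<exists>u d. u \<noteq> 0 \<and> c ` I \<subseteq> {x. u \<bullet> x = d})"

text \<open>\<open>c\<close> is a unit speed curve with nonvanishing curvature, so that its principal normal lines are
  well defined, and they are also the principal normal lines of another curve \<open>b\<close> (the mate) at
  corresponding parameters. The mate is neither \<open>c\<close> itself nor a single point; its parameter is
  that of \<open>c\<close>, so its speed \<open>v\<close> is arbitrary. If \<open>\<tau> s \<noteq> 0\<close>, then \<open>v s \<noteq> 0\<close> automatically, since
  \<open>b = c + \<lambda> N\<close> with a constant \<open>\<lambda> \<noteq> 0\<close> and the derivative of \<open>b\<close> has \<open>B\<close>-component \<open>\<lambda> * \<tau>\<close>; thus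
  singular mates only occur where the torsion of \<open>c\<close> vanishes.\<close>

definition bertrand_curve :: "real set \<Rightarrow> (real \<Rightarrow> real^3) \<Rightarrow> bool" where
  "bertrand_curve I c \<longleftrightarrow>
     (\<exists>T N B \<kappa> \<tau>. frenet_frame I c T N B \<kappa> \<tau> \<and> (\<forall>s\<in>I. \<kappa> s \<noteq> 0) \<and>
       (\<exists>b v T' N' B' k l. frenet_frame_speed I b v T' N' B' k l \<and> \<not> b constant_on I \<and>
          (\<exists>s\<in>I. b s \<noteq> c s) \<and> (\<forall>s\<in>I. normal_line b N' s = normal_line c N s)))"

text \<open>For curves parameterized by arc-length: the unit tangent makes the constant angle \<open>\<theta>\<close> with \<open>u\<close>.\<close>

definition generalized_helix :: "real set \<Rightarrow> (real \<Rightarrow> real^3) \<Rightarrow> bool" where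
  "generalized_helix I c \<longleftrightarrow>
     (\<exists>u \<theta>. norm u = 1 \<and> (\<forall>s\<in>I. vector_derivative c (at s within I) \<bullet> u = cos \<theta>))"

end

theory Submission
  imports Defs
begin

text \<open>The mate \<open>\<gamma>\<close> has the Frenet frame \<open>(n1, -t, n2)\<close> with curvature \<open>\<kappa>1\<close> and torsion \<open>-\<kappa>2\<close>.
  The coordinates of \<open>\<alpha> - p\<close> with respect to \<open>n1, n2\<close> are constant when \<open>\<alpha>\<close> lies on a sphere
  around \<open>p\<close>, so being spherical amounts to an affine relation \<open>1 + x * \<kappa>1 + y * \<kappa>2 = 0\<close> with constant
  coefficients, and this is the classical characterization of Bertrand curves by their curvature
  and torsion. Similarly, \<open>u \<bullet> n1\<close> has the derivative \<open>-\<kappa>1 * (u \<bullet> t)\<close>, so \<open>n1\<close> makes a constant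
  angle with \<open>u\<close> if and only if \<open>u\<close> is normal to \<open>\<alpha>\<close>.\<close>

section \<open>Differentiating inner products along an interval\<close>

text \<open>An interval with nonempty interior has no isolated points, so the one-sided derivatives
  at its end points are unique as well.\<close>

lemma has_vector_derivative_unique_interval:
  fixes f :: "real \<Rightarrow> 'a::real_normed_vector"
  assumes "is_interval I" "interior I \<noteq> {}" "s \<in> I"
    and "(f has_vector_derivative a) (at s within I)" "(f has_vector_derivative b) (at s within I)"
  shows "a = b"
proof -
  have "connected I" using assms(1) by (simp add: is_interval_connected)
  moreover have "I \<noteq> {s}" using assms(2) by auto
  ultimately have "at s within I \<noteq> bot"
    using assms(3) connected_imp_perfect[of I s] by (auto simp: trivial_limit_within)
  then show ?thesis
    using assms(4,5) by (rule vector_derivative_unique_within)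
qed

lemma has_vector_derivative_inner:
  fixes f g :: "real \<Rightarrow> 'a::real_inner"
  assumes "(f has_vector_derivative f') (at s within I)"
    and "(g has_vector_derivative g') (at s within I)"
  shows "((\<lambda>s. f s \<bullet> g s) has_vector_derivative f s \<bullet> g' + f' \<bullet> g s) (at s within I)"
  using bounded_bilinear.has_vector_derivative[OF bounded_bilinear_inner assms] .

text \<open>The product rule and uniqueness of derivatives turn a geometric constancy into an
  equation at each parameter. The lemma after it is the converse, by convexity of the
  interval.\<close>

lemma inner_derivative_zero_if_constant:
  fixes f g :: "real \<Rightarrow> 'a::real_inner"
  assumes "is_interval I" "interior I \<noteq> {}" "s \<in> I"
    and "(f has_vector_derivative f') (at s within I)"
    and "(g has_vector_derivative g') (at s within I)"
    and "\<And>s. s \<in> I \<Longrightarrow> f s \<bullet> g s = c"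
  shows "f s \<bullet> g' + f' \<bullet> g s = 0"
proof -
  have "((\<lambda>_. c) has_vector_derivative f s \<bullet> g' + f' \<bullet> g s) (at s within I)"
    by (rule has_vector_derivative_transform[OF assms(3) _ has_vector_derivative_inner[OF assms(4,5)]])
      (simp add: assms(6))
  then show ?thesis
    using has_vector_derivative_unique_interval[OF assms(1-3)] has_vector_derivative_const by blast
qed

lemma inner_constant_if_derivative_zero:
  fixes f g :: "real \<Rightarrow> 'a::real_inner"
  assumes "is_interval I"
    and "\<And>s. s \<in> I \<Longrightarrow> (f has_vector_derivative f' s) (at s within I)"
    and "\<And>s. s \<in> I \<Longrightarrow> (g has_vector_derivative g' s) (at s within I)"
    and "\<And>s. s \<in> I \<Longrightarrow> f s \<bullet> g' s + f' s \<bullet> g s = 0"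
  obtains c where "\<And>s. s \<in> I \<Longrightarrow> f s \<bullet> g s = c"
proof -
  have "((\<lambda>s. f s \<bullet> g s) has_vector_derivative 0) (at s within I)" if "s \<in> I" for s
    using has_vector_derivative_inner[OF assms(2,3)[OF that]] assms(4)[OF that] by simp
  moreover have "convex I" using assms(1) by (rule is_interval_convex)
  ultimately show thesis
    using has_vector_derivative_zero_constant[of I "\<lambda>s. f s \<bullet> g s"] that by blast
qed

section \<open>Orthonormal frames of space\<close>

lemma orthonormal3_inner:
  assumes "orthonormal3 a b c"
  shows "a \<bullet> a = 1" "b \<bullet> b = 1" "c \<bullet> c = 1" "a \<bullet> b = 0" "a \<bullet> c = 0" "b \<bullet> c = 0"
    "b \<bullet> a = 0" "c \<bullet> a = 0" "c \<bullet> b = 0"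
  using assms by (auto simp: orthonormal3_def norm_eq_1 inner_commute)

text \<open>Orthonormal vectors are independent, and three of them span the space by dimension
  count.\<close>

lemma orthonormal3_expand:
  assumes "orthonormal3 a b c"
  shows "x = (x \<bullet> a) *\<^sub>R a + (x \<bullet> b) *\<^sub>R b + (x \<bullet> c) *\<^sub>R c"
proof -
  let ?S = "{a, b, c}"
  note o = orthonormal3_inner[OF assms]
  have ne: "a \<noteq> b" "a \<noteq> c" "b \<noteq> c" and nz: "a \<noteq> 0" "b \<noteq> 0" "c \<noteq> 0"
    using o by auto
  have po: "pairwise orthogonal ?S"
    using o by (auto simp: pairwise_def orthogonal_def)
  have "independent ?S"
    using pairwise_orthogonal_independent[OF po] nz by auto
  moreover have "card ?S = DIM(real^3)" using ne by simp
  ultimately have "UNIV \<subseteq> span ?S"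
    using card_ge_dim_independent[of ?S UNIV] by simp
  then have "x \<in> span ?S" by blast
  then have "(\<Sum>v\<in>?S. (x \<bullet> v) *\<^sub>R v) = x"
    using orthonormal_basis_expand[OF po] assms by (auto simp: orthonormal3_def)
  then show ?thesis using ne by (simp add: add.assoc)
qed

section \<open>Bertrand mates from a rotated frame\<close>

text \<open>This is a rotation about the axis \<open>N\<close>, with cosine \<open>a\<close> and
  sine \<open>b\<close>.\<close>

lemma orthonormal3_rotate:
  assumes "orthonormal3 T N B" "a\<^sup>2 + b\<^sup>2 = 1"
  shows "orthonormal3 (a *\<^sub>R T + b *\<^sub>R B) N (- b *\<^sub>R T + a *\<^sub>R B)"
  using assms(2) unfolding orthonormal3_def
  by (simp add: norm_eq_1 inner_add_left inner_add_right orthonormal3_inner[OF assms(1)]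
      power2_eq_square algebra_simps)

text \<open>The hypotheses on \<open>v\<close> say that the curve \<open>c + \<delta> N\<close> has the velocity \<open>v (a T + b B)\<close>, so that its
  tangent arises from the frame of \<open>c\<close> by a fixed rotation about \<open>N\<close>.\<close>

lemma bertrand_curveI:
  assumes I: "is_interval I" "interior I \<noteq> {}"
    and fr: "frenet_frame I c T N B \<kappa> \<tau>" and "\<forall>s\<in>I. \<kappa> s \<noteq> 0"
    and "\<delta> \<noteq> 0" and ab: "a\<^sup>2 + b\<^sup>2 = 1"
    and v: "\<And>s. s \<in> I \<Longrightarrow> 1 - \<delta> * \<kappa> s = v s * a" "\<And>s. s \<in> I \<Longrightarrow> \<delta> * \<tau> s = v s * b"
    and s0: "s0 \<in> I" "v s0 \<noteq> 0"
  shows "bertrand_curve I c"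
proof -
  let ?T = "\<lambda>s. a *\<^sub>R T s + b *\<^sub>R B s" and ?B = "\<lambda>s. - b *\<^sub>R T s + a *\<^sub>R B s"
    and ?m = "\<lambda>s. c s + \<delta> *\<^sub>R N s"
  \<comment> \<open>The pair \<open>(\<kappa>, \<tau>)\<close> is rotated by the same angle as the
    frame.\<close>
  let ?k = "\<lambda>s. a * \<kappa> s - b * \<tau> s" and ?l = "\<lambda>s. b * \<kappa> s + a * \<tau> s"
  note sc = bounded_linear.has_vector_derivative[OF bounded_linear_scaleR_right]
  have mate: "frenet_frame_speed I ?m v ?T N ?B ?k ?l"
    unfolding frenet_frame_speed_def
  proof (intro ballI conjI)
    fix s assume s: "s \<in> I"
    then have o: "orthonormal3 (T s) (N s) (B s)"
      and dc: "(c has_vector_derivative T s) (at s within I)"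
      and dT: "(T has_vector_derivative \<kappa> s *\<^sub>R N s) (at s within I)"
      and dN: "(N has_vector_derivative - (\<kappa> s *\<^sub>R T s) + \<tau> s *\<^sub>R B s) (at s within I)"
      and dB: "(B has_vector_derivative - (\<tau> s *\<^sub>R N s)) (at s within I)"
      using fr by (auto simp: frenet_frame_speed_def)
    show "orthonormal3 (?T s) (N s) (?B s)" by (rule orthonormal3_rotate[OF o ab])
    have "T s + \<delta> *\<^sub>R (- (\<kappa> s *\<^sub>R T s) + \<tau> s *\<^sub>R B s) = (1 - \<delta> * \<kappa> s) *\<^sub>R T s + (\<delta> * \<tau> s) *\<^sub>R B s"
      by (simp add: algebra_simps)
    also have "\<dots> = v s *\<^sub>R ?T s" unfolding v[OF s] by (simp add: algebra_simps)
    finally show "(?m has_vector_derivative v s *\<^sub>R ?T s) (at s within I)"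
      using has_vector_derivative_add[OF dc sc[OF dN, of \<delta>]] by simp
    show "(?T has_vector_derivative ?k s *\<^sub>R N s) (at s within I)"
      using has_vector_derivative_add[OF sc[OF dT, of a] sc[OF dB, of b]]
      by (simp add: algebra_simps)
    show "(?B has_vector_derivative - (?l s *\<^sub>R N s)) (at s within I)"
      using has_vector_derivative_add[OF sc[OF dT, of "-b"] sc[OF dB, of a]]
      by (simp add: algebra_simps)
    have "- (?k s *\<^sub>R ?T s) + ?l s *\<^sub>R ?B s
        = (- (a\<^sup>2 + b\<^sup>2) * \<kappa> s) *\<^sub>R T s + ((a\<^sup>2 + b\<^sup>2) * \<tau> s) *\<^sub>R B s"
      by (simp add: algebra_simps power2_eq_square)
    then show "(N has_vector_derivative - (?k s *\<^sub>R ?T s) + ?l s *\<^sub>R ?B s) (at s within I)"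
      using dN ab by simp
  qed
  have "\<not> ?m constant_on I"
  proof
    assume "?m constant_on I"
    then obtain y where y: "\<And>s. s \<in> I \<Longrightarrow> ?m s = y" by (auto simp: constant_on_def)
    have "(?m has_vector_derivative v s0 *\<^sub>R ?T s0) (at s0 within I)"
      using mate s0 by (auto simp: frenet_frame_speed_def)
    then have "((\<lambda>_. y) has_vector_derivative v s0 *\<^sub>R ?T s0) (at s0 within I)"
      by (rule has_vector_derivative_transform[OF s0(1), rotated]) (simp add: y)
    then have "v s0 *\<^sub>R ?T s0 = 0"
      using has_vector_derivative_unique_interval[OF I s0(1)] has_vector_derivative_const by blast
    moreover have "norm (?T s0) = 1"
      using mate s0(1) by (simp add: frenet_frame_speed_def orthonormal3_def)
    ultimately show False using s0(2) by auto
  qed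
  moreover have "?m s0 \<noteq> c s0"
    using fr s0(1) \<open>\<delta> \<noteq> 0\<close> by (auto simp: frenet_frame_speed_def orthonormal3_def)
  moreover have "normal_line ?m N s = normal_line c N s" for s
  proof -
    \<comment> \<open>Moving the base point by \<open>\<delta>\<close> along the line only shifts
      the line parameter.\<close>
    have "normal_line ?m N s = (\<lambda>r. c s + r *\<^sub>R N s) ` range ((+) \<delta>)"
      unfolding normal_line_def image_image by (simp add: algebra_simps)
    then show ?thesis by (simp add: normal_line_def)
  qed
  ultimately show ?thesis
    using mate fr assms(4) s0(1) unfolding bertrand_curve_def by blast
qed

section \<open>Plane curves and generalized helices\<close>

lemma plane_iff_helix:
  assumes I: "is_interval I" "interior I \<noteq> {}"
    and fr: "rm_frame I \<alpha> t n1 n2 \<kappa>1 \<kappa>2"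
    and \<gamma>: "\<forall>s\<in>I. (\<gamma> has_vector_derivative n1 s) (at s within I)"
    and \<kappa>: "\<forall>s\<in>I. \<kappa>1 s \<noteq> 0"
  shows "plane_curve I \<alpha> \<longleftrightarrow> generalized_helix I \<gamma>"
proof -
  have d\<alpha>: "(\<alpha> has_vector_derivative t s) (at s within I)"
    and d1: "(n1 has_vector_derivative - (\<kappa>1 s *\<^sub>R t s)) (at s within I)"
    and unit: "norm (n1 s) = 1" if "s \<in> I" for s
    using fr that by (auto simp: rm_frame_def orthonormal3_def)
  have vd: "vector_derivative \<gamma> (at s within I) = n1 s" if "s \<in> I" for s
    using has_vector_derivative_unique_interval[OF I that] \<gamma> that
      vector_derivative_works differentiableI_vector by blast
  note const = has_vector_derivative_const
  obtain s0 where s0: "s0 \<in> I" using I(2) interior_subset by blast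
  show ?thesis
  proof
    assume "plane_curve I \<alpha>"
    then obtain u d where "u \<noteq> 0" and "\<alpha> ` I \<subseteq> {x. u \<bullet> x = d}"
      unfolding plane_curve_def by blast
    then have d: "u \<bullet> \<alpha> s = d" if "s \<in> I" for s using that by blast
    define w where "w = sgn u"
    have w: "norm w = 1" using \<open>u \<noteq> 0\<close> by (simp add: w_def norm_sgn)
    have "w \<bullet> t s = 0" if "s \<in> I" for s
      using inner_derivative_zero_if_constant[OF I that const d\<alpha>[OF that] d]
      by (simp add: w_def sgn_div_norm)
    then obtain c where c: "\<And>s. s \<in> I \<Longrightarrow> w \<bullet> n1 s = c"
      using inner_constant_if_derivative_zero[OF I(1) const d1, of w] by auto
    \<comment> \<open>Cauchy-Schwarz puts \<open>c\<close> into the range of the cosine, so it is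
      the cosine of an angle.\<close>
    have "\<bar>c\<bar> \<le> 1"
      using Cauchy_Schwarz_ineq2[of w "n1 s0"] c[OF s0] w unit[OF s0] by simp
    then have "cos (arccos c) = c" by (intro cos_arccos_abs)
    then show "generalized_helix I \<gamma>"
      unfolding generalized_helix_def using w c vd by (metis inner_commute)
  next
    assume "generalized_helix I \<gamma>"
    then obtain u \<theta> where u: "norm u = 1" and "\<And>s. s \<in> I \<Longrightarrow> u \<bullet> n1 s = cos \<theta>"
      unfolding generalized_helix_def using vd by (metis inner_commute)
    \<comment> \<open>Differentiation yields \<open>\<kappa>1 s * (u \<bullet> t s) = 0\<close>, and
      the nonvanishing factor \<open>\<kappa>1 s\<close> is cancelled.\<close>
    then have "u \<bullet> t s = 0" if "s \<in> I" for s
      using inner_derivative_zero_if_constant[OF I that const d1[OF that], of u "cos \<theta>"] \<kappa> that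
      by simp
    then obtain d where "\<And>s. s \<in> I \<Longrightarrow> u \<bullet> \<alpha> s = d"
      using inner_constant_if_derivative_zero[OF I(1) const d\<alpha>, of u] by auto
    moreover have "u \<noteq> 0" using u by auto
    ultimately show "plane_curve I \<alpha>" unfolding plane_curve_def by blast
  qed
qed

section \<open>Spherical curves and the affine relation\<close>

text \<open>Here \<open>x\<close> and \<open>y\<close> are the coordinates of
  \<open>\<alpha> - p\<close> along \<open>n1\<close> and \<open>n2\<close>, with \<open>p\<close>
  the centre. The relation is the derivative of the orthogonality of \<open>\<alpha> - p\<close> and
  \<open>t\<close>; conversely, it makes the candidate centre stationary.\<close>

lemma spherical_curve_iff:
  assumes I: "is_interval I" "interior I \<noteq> {}"
    and fr: "rm_frame I \<alpha> t n1 n2 \<kappa>1 \<kappa>2"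
  shows "spherical_curve I \<alpha> \<longleftrightarrow> (\<exists>x y. \<forall>s\<in>I. 1 + x * \<kappa>1 s + y * \<kappa>2 s = 0)"
proof -
  have o: "orthonormal3 (t s) (n1 s) (n2 s)"
    and d\<alpha>: "(\<alpha> has_vector_derivative t s) (at s within I)"
    and dt: "(t has_vector_derivative \<kappa>1 s *\<^sub>R n1 s + \<kappa>2 s *\<^sub>R n2 s) (at s within I)"
    and d1: "(n1 has_vector_derivative - (\<kappa>1 s *\<^sub>R t s)) (at s within I)"
    and d2: "(n2 has_vector_derivative - (\<kappa>2 s *\<^sub>R t s)) (at s within I)" if "s \<in> I" for s
    using fr that by (auto simp: rm_frame_def)
  show ?thesis
  proof
    assume "spherical_curve I \<alpha>"
    then obtain p r where "\<alpha> ` I \<subseteq> sphere p r"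
      unfolding spherical_curve_def by blast
    then have r: "norm (\<alpha> s - p) = r" if "s \<in> I" for s
      using that by (auto simp: dist_norm norm_minus_commute)
    have d: "((\<lambda>s. \<alpha> s - p) has_vector_derivative t s) (at s within I)" if "s \<in> I" for s
      using has_vector_derivative_diff[OF d\<alpha>[OF that] has_vector_derivative_const] by simp
    have perp: "(\<alpha> s - p) \<bullet> t s = 0" if "s \<in> I" for s
    proof -
      have "(\<alpha> s - p) \<bullet> (\<alpha> s - p) = r\<^sup>2" if "s \<in> I" for s
        using r[OF that] by (simp add: power2_norm_eq_inner[symmetric])
      then show ?thesis
        using inner_derivative_zero_if_constant[OF I that d[OF that] d[OF that]]
        by (simp add: inner_commute)
    qed
    \<comment> \<open>The derivatives of \<open>\<alpha> - p\<close> and \<open>n1\<close> are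
      multiples of \<open>t\<close>, which is orthogonal to both fields.\<close>
    obtain x where x: "\<And>s. s \<in> I \<Longrightarrow> (\<alpha> s - p) \<bullet> n1 s = x"
      by (rule inner_constant_if_derivative_zero[OF I(1) d d1])
        (use perp orthonormal3_inner[OF o] in auto)
    obtain y where y: "\<And>s. s \<in> I \<Longrightarrow> (\<alpha> s - p) \<bullet> n2 s = y"
      by (rule inner_constant_if_derivative_zero[OF I(1) d d2])
        (use perp orthonormal3_inner[OF o] in auto)
    have "1 + x * \<kappa>1 s + y * \<kappa>2 s = 0" if "s \<in> I" for s
      using inner_derivative_zero_if_constant[OF I that d[OF that] dt[OF that] perp]
        x[OF that] y[OF that] orthonormal3_inner[OF o[OF that]]
      by (simp add: inner_add_right algebra_simps)
    then show "\<exists>x y. \<forall>s\<in>I. 1 + x * \<kappa>1 s + y * \<kappa>2 s = 0" by blast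
  next
    assume "\<exists>x y. \<forall>s\<in>I. 1 + x * \<kappa>1 s + y * \<kappa>2 s = 0"
    then obtain x y where xy: "\<And>s. s \<in> I \<Longrightarrow> 1 + x * \<kappa>1 s + y * \<kappa>2 s = 0" by blast
    let ?p = "\<lambda>s. \<alpha> s - (x *\<^sub>R n1 s + y *\<^sub>R n2 s)"
    note sc = bounded_linear.has_vector_derivative[OF bounded_linear_scaleR_right]
    have "(?p has_vector_derivative 0) (at s within I)" if "s \<in> I" for s
    proof -
      have "t s - (x *\<^sub>R - (\<kappa>1 s *\<^sub>R t s) + y *\<^sub>R - (\<kappa>2 s *\<^sub>R t s))
          = (1 + x * \<kappa>1 s + y * \<kappa>2 s) *\<^sub>R t s" by (simp add: algebra_simps)
      then show ?thesis
        using has_vector_derivative_diff[OF d\<alpha>[OF that]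
            has_vector_derivative_add[OF sc[OF d1[OF that], of x] sc[OF d2[OF that], of y]]] xy[OF that]
        by simp
    qed
    then obtain p where p: "\<And>s. s \<in> I \<Longrightarrow> ?p s = p"
      using has_vector_derivative_zero_constant[of I ?p] is_interval_convex[OF I(1)] by blast
    have "\<alpha> s \<in> sphere p (sqrt (x\<^sup>2 + y\<^sup>2))" if "s \<in> I" for s
    proof -
      have "p - \<alpha> s = - (x *\<^sub>R n1 s + y *\<^sub>R n2 s)" using p[OF that] by auto
      then have "dist p (\<alpha> s) = norm (x *\<^sub>R n1 s + y *\<^sub>R n2 s)"
        by (simp add: dist_norm norm_minus_cancel del: minus_add_distrib)
      also have "\<dots> = sqrt (x\<^sup>2 + y\<^sup>2)"
        using orthonormal3_inner[OF o[OF that]]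
        by (simp add: norm_eq_sqrt_inner inner_add_left inner_add_right power2_eq_square)
      finally show ?thesis by simp
    qed
    moreover obtain s0 where "s0 \<in> I" using I(2) interior_subset by blast
    \<comment> \<open>With both coefficients zero the relation would read \<open>1 = 0\<close> at
      \<open>s0\<close>; hence the radius is positive.\<close>
    then have "x \<noteq> 0 \<or> y \<noteq> 0" using xy by force
    then have "0 < sqrt (x\<^sup>2 + y\<^sup>2)" by (simp add: sum_power2_gt_zero_iff)
    ultimately show "spherical_curve I \<alpha>" unfolding spherical_curve_def by blast
  qed
qed

section \<open>From an affine relation to a Bertrand mate\<close>

lemma rm_mate_frenet_frame:
  assumes "rm_frame I \<alpha> t n1 n2 \<kappa>1 \<kappa>2"
    and "\<forall>s\<in>I. (\<gamma> has_vector_derivative n1 s) (at s within I)"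
  shows "frenet_frame I \<gamma> n1 (\<lambda>s. - t s) n2 \<kappa>1 (\<lambda>s. - \<kappa>2 s)"
  unfolding frenet_frame_speed_def
proof (intro ballI conjI)
  fix s assume s: "s \<in> I"
  then show "orthonormal3 (n1 s) (- t s) (n2 s)"
    using assms(1) by (auto simp: rm_frame_def orthonormal3_def inner_commute)
  show "((\<lambda>s. - t s) has_vector_derivative - (\<kappa>1 s *\<^sub>R n1 s) + - \<kappa>2 s *\<^sub>R n2 s) (at s within I)"
    using assms(1) s has_vector_derivative_minus[of t "\<kappa>1 s *\<^sub>R n1 s + \<kappa>2 s *\<^sub>R n2 s" "at s within I"]
    by (auto simp: rm_frame_def)
qed (use assms in \<open>auto simp: rm_frame_def\<close>)

text \<open>By the relation, \<open>c + x N\<close> has velocity \<open>\<tau> (y T + x B)\<close>,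
  whose direction is fixed in the frame. This gives no mate if \<open>x = 0\<close> or if
  \<open>\<tau>\<close> vanishes identically. Either way \<open>\<tau>\<close> is constant, hence so
  is \<open>\<kappa>\<close>, and that case gets a mate of its own.\<close>

lemma bertrand_if_affine_relation:
  assumes I: "is_interval I" "interior I \<noteq> {}"
    and fr: "frenet_frame I c T N B \<kappa> \<tau>" and \<kappa>: "\<forall>s\<in>I. \<kappa> s \<noteq> 0"
    and imp: "\<tau> constant_on I \<longrightarrow> \<kappa> constant_on I"
    and xy: "\<And>s. s \<in> I \<Longrightarrow> x * \<kappa> s + y * \<tau> s = 1"
  shows "bertrand_curve I c"
proof (cases "\<tau> constant_on I")
  case True
  then obtain k l where kl: "\<And>s. s \<in> I \<Longrightarrow> \<kappa> s = k" "\<And>s. s \<in> I \<Longrightarrow> \<tau> s = l"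
    using imp unfolding constant_on_def by blast
  obtain s0 where s0: "s0 \<in> I" using I(2) interior_subset by blast
  then have "k \<noteq> 0" using \<kappa> kl by auto
  \<comment> \<open>Every distance is possible here except \<open>1 / k\<close> in the case \<open>l = 0\<close>, where the mate is a point.\<close>
  define \<delta> where "\<delta> = 2 / k"
  \<comment> \<open>The mate at distance \<open>\<delta>\<close> has velocity
    \<open>- T + \<delta> l B\<close>, of constant length \<open>\<rho>\<close>.\<close>
  define \<rho> where "\<rho> = sqrt (1 + (\<delta> * l)\<^sup>2)"
  have \<rho>2: "\<rho>\<^sup>2 = 1 + (\<delta> * l)\<^sup>2" and "\<rho> \<noteq> 0"
    by (auto simp: \<rho>_def add_nonneg_eq_0_iff)
  have "\<delta> * k = 2" using \<open>k \<noteq> 0\<close> by (simp add: \<delta>_def)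
  have "(-1 / \<rho>)\<^sup>2 + (\<delta> * l / \<rho>)\<^sup>2 = (1 + (\<delta> * l)\<^sup>2) / \<rho>\<^sup>2"
    by (simp add: power_divide add_divide_distrib)
  then have ab: "(-1 / \<rho>)\<^sup>2 + (\<delta> * l / \<rho>)\<^sup>2 = 1"
    unfolding \<rho>2[symmetric] using \<open>\<rho> \<noteq> 0\<close> by simp
  show ?thesis
  proof (rule bertrand_curveI[OF I fr \<kappa> _ ab])
    show "1 - \<delta> * \<kappa> s = \<rho> * (-1 / \<rho>)" "\<delta> * \<tau> s = \<rho> * (\<delta> * l / \<rho>)" if "s \<in> I" for s
      using that kl \<open>\<delta> * k = 2\<close> \<open>\<rho> \<noteq> 0\<close> by auto
  qed (use s0 \<open>\<rho> \<noteq> 0\<close> \<open>\<delta> * k = 2\<close> in auto)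
next
  case False
  have "x \<noteq> 0"
  proof
    assume "x = 0"
    then have "\<tau> s = 1 / y" if "s \<in> I" for s
      using xy[OF that] by (cases "y = 0") (auto simp: field_simps)
    then show False using False by (auto simp: constant_on_def)
  qed
  \<comment> \<open>Dividing by \<open>\<rho>\<close> makes \<open>y\<close> and \<open>x\<close> a
    cosine and a sine; the signed speed becomes \<open>\<tau> s * \<rho>\<close>.\<close>
  define \<rho> where "\<rho> = sqrt (x\<^sup>2 + y\<^sup>2)"
  have \<rho>2: "\<rho>\<^sup>2 = x\<^sup>2 + y\<^sup>2" by (simp add: \<rho>_def)
  then have "\<rho> \<noteq> 0" using \<open>x \<noteq> 0\<close> by (auto simp: sum_power2_eq_zero_iff)
  have "(y / \<rho>)\<^sup>2 + (x / \<rho>)\<^sup>2 = (x\<^sup>2 + y\<^sup>2) / \<rho>\<^sup>2"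
    by (simp add: power_divide add_divide_distrib)
  then have ab: "(y / \<rho>)\<^sup>2 + (x / \<rho>)\<^sup>2 = 1"
    unfolding \<rho>2[symmetric] using \<open>\<rho> \<noteq> 0\<close> by simp
  \<comment> \<open>A parameter of nonzero torsion has nonzero speed, so the mate is not a single
    point.\<close>
  obtain s0 where s0: "s0 \<in> I" "\<tau> s0 \<noteq> 0"
    using False unfolding constant_on_def by blast
  have "1 - x * \<kappa> s = (\<tau> s * \<rho>) * (y / \<rho>)" "x * \<tau> s = (\<tau> s * \<rho>) * (x / \<rho>)" if "s \<in> I" for s
    using xy[OF that] \<open>\<rho> \<noteq> 0\<close> by (auto simp: algebra_simps)
  then show ?thesis
    by (rule bertrand_curveI[OF I fr \<kappa> \<open>x \<noteq> 0\<close> ab _ _ s0(1)]) (use s0 \<open>\<rho> \<noteq> 0\<close> in auto)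
qed

section \<open>From a Bertrand mate to an affine relation\<close>

text \<open>The points with \<open>r = 0\<close> and \<open>r = 1\<close> of the first line lie on
  the second, and their difference gives the direction.\<close>

lemma normal_line_eqD:
  assumes "normal_line b M s = normal_line c N s"
  obtains \<mu> \<nu> where "b s = c s + \<mu> *\<^sub>R N s" "M s = \<nu> *\<^sub>R N s"
proof -
  have "b s + 0 *\<^sub>R M s \<in> normal_line c N s" "b s + 1 *\<^sub>R M s \<in> normal_line c N s"
    using assms unfolding normal_line_def by blast+
  then obtain \<mu> \<mu>' where "b s + 0 *\<^sub>R M s = c s + \<mu> *\<^sub>R N s" "b s + 1 *\<^sub>R M s = c s + \<mu>' *\<^sub>R N s"
    unfolding normal_line_def by blast
  then show thesis
    by (intro that[of \<mu> "\<mu>' - \<mu>"]) (auto simp: algebra_simps)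
qed

text \<open>The angle between the tangents of a curve and of its Bertrand mate is constant, and so is
  their distance \<open>\<delta>\<close>; comparing velocities gives the linear relation.\<close>

lemma bertrand_mate_relation:
  assumes I: "is_interval I" "interior I \<noteq> {}"
    and fr: "frenet_frame I c T N B \<kappa> \<tau>"
    and fr': "frenet_frame_speed I b v T' N' B' k l"
    and lines: "\<And>s. s \<in> I \<Longrightarrow> normal_line b N' s = normal_line c N s"
    and ne: "\<exists>s\<in>I. b s \<noteq> c s"
  obtains \<delta> p q where "\<delta> \<noteq> 0" "p \<noteq> 0 \<or> q \<noteq> 0"
    "\<And>s. s \<in> I \<Longrightarrow> q * (1 - \<delta> * \<kappa> s) = p * (\<delta> * \<tau> s)"
proof -
  have o: "orthonormal3 (T s) (N s) (B s)"
    and dc: "(c has_vector_derivative T s) (at s within I)"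
    and dT: "(T has_vector_derivative \<kappa> s *\<^sub>R N s) (at s within I)"
    and dN: "(N has_vector_derivative - (\<kappa> s *\<^sub>R T s) + \<tau> s *\<^sub>R B s) (at s within I)"
    and dB: "(B has_vector_derivative - (\<tau> s *\<^sub>R N s)) (at s within I)"
    and o': "orthonormal3 (T' s) (N' s) (B' s)"
    and db: "(b has_vector_derivative v s *\<^sub>R T' s) (at s within I)"
    and dT': "(T' has_vector_derivative k s *\<^sub>R N' s) (at s within I)"
    if "s \<in> I" for s
    using that fr fr' by (auto simp: frenet_frame_speed_def)
  note oi = orthonormal3_inner[OF o]
  have bc: "\<exists>\<mu>. b s - c s = \<mu> *\<^sub>R N s" and N': "\<exists>\<nu>. N' s = \<nu> *\<^sub>R N s" if "s \<in> I" for s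
    using normal_line_eqD[OF lines[OF that]] by (metis add_diff_cancel_left')+
  have T'N: "T' s \<bullet> N s = 0" if s: "s \<in> I" for s
  proof -
    obtain \<nu> where \<nu>: "N' s = \<nu> *\<^sub>R N s" using N'[OF s] by blast
    then have "\<nu> \<noteq> 0" using orthonormal3_inner(2)[OF o'[OF that]] by auto
    then show ?thesis using orthonormal3_inner(4)[OF o'[OF that]] \<nu> by simp
  qed
  have d: "((\<lambda>s. b s - c s) has_vector_derivative v s *\<^sub>R T' s - T s) (at s within I)" if "s \<in> I" for s
    by (rule has_vector_derivative_diff[OF db[OF that] dc[OF that]])
  \<comment> \<open>Both summands vanish: \<open>b - c\<close> is parallel to \<open>N\<close>,
    whose derivative is orthogonal to \<open>N\<close>, and both tangents are orthogonal to
    \<open>N\<close>.\<close>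
  have zero: "(b s - c s) \<bullet> (- (\<kappa> s *\<^sub>R T s) + \<tau> s *\<^sub>R B s) + (v s *\<^sub>R T' s - T s) \<bullet> N s = 0"
    if s: "s \<in> I" for s
  proof -
    obtain \<mu> where "b s - c s = \<mu> *\<^sub>R N s" using bc[OF s] by blast
    then show ?thesis
      using T'N[OF s] oi[OF s] by (simp add: inner_add_right inner_diff_left inner_diff_right)
  qed
  obtain \<delta> where "\<And>s. s \<in> I \<Longrightarrow> (b s - c s) \<bullet> N s = \<delta>"
    by (rule inner_constant_if_derivative_zero[OF I(1) d dN]) (use zero in auto)
  then have \<delta>: "b s - c s = \<delta> *\<^sub>R N s" if "s \<in> I" for s
    using bc[OF that] oi(2)[OF that] that by fastforce
  have "\<delta> \<noteq> 0" using ne \<delta> by force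
  \<comment> \<open>The derivative of \<open>b - c\<close> is computed in two ways, once from
    \<open>\<delta> N\<close>.\<close>
  have eq: "v s *\<^sub>R T' s = (1 - \<delta> * \<kappa> s) *\<^sub>R T s + (\<delta> * \<tau> s) *\<^sub>R B s" if "s \<in> I" for s
  proof -
    have "((\<lambda>s. \<delta> *\<^sub>R N s) has_vector_derivative v s *\<^sub>R T' s - T s) (at s within I)"
      by (rule has_vector_derivative_transform[OF that _ d[OF that]]) (simp add: \<delta>)
    then have "v s *\<^sub>R T' s - T s = \<delta> *\<^sub>R (- (\<kappa> s *\<^sub>R T s) + \<tau> s *\<^sub>R B s)"
      using has_vector_derivative_unique_interval[OF I that]
        bounded_linear.has_vector_derivative[OF bounded_linear_scaleR_right dN[OF that]] by blast
    then show ?thesis by (simp add: algebra_simps)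
  qed
  have orth: "N' s \<bullet> T s = 0" "N' s \<bullet> B s = 0" if "s \<in> I" for s
    using N'[OF that] oi[OF that] by auto
  \<comment> \<open>The derivatives of \<open>T'\<close>, \<open>T\<close> and \<open>B\<close> are
    all parallel to \<open>N\<close>, so \<open>T'\<close> keeps constant components along
    \<open>T\<close> and \<open>B\<close>.\<close>
  obtain p where p: "\<And>s. s \<in> I \<Longrightarrow> T' s \<bullet> T s = p"
    by (rule inner_constant_if_derivative_zero[OF I(1) dT' dT]) (use orth T'N in auto)
  obtain q where q: "\<And>s. s \<in> I \<Longrightarrow> T' s \<bullet> B s = q"
    by (rule inner_constant_if_derivative_zero[OF I(1) dT' dB]) (use orth T'N in auto)
  have "p \<noteq> 0 \<or> q \<noteq> 0"
  proof -
    obtain s where s: "s \<in> I" using ne by blast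
    have "T' s = p *\<^sub>R T s + q *\<^sub>R B s"
      using orthonormal3_expand[OF o[OF s], of "T' s"] p[OF s] q[OF s] T'N[OF s] by simp
    moreover have "T' s \<noteq> 0" using orthonormal3_inner(1)[OF o'[OF s]] by auto
    ultimately show ?thesis by auto
  qed
  moreover have "q * (1 - \<delta> * \<kappa> s) = p * (\<delta> * \<tau> s)" if "s \<in> I" for s
  proof -
    \<comment> \<open>Comparing components and eliminating \<open>v s\<close> by cross
      multiplication avoids dividing by a speed that may vanish.\<close>
    have "v s * p = 1 - \<delta> * \<kappa> s" "v s * q = \<delta> * \<tau> s"
      using arg_cong[OF eq[OF that], of "\<lambda>x. x \<bullet> T s"] arg_cong[OF eq[OF that], of "\<lambda>x. x \<bullet> B s"]
        p[OF that] q[OF that] oi[OF that] by (simp_all add: inner_add_left)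
    then show ?thesis by (metis mult.assoc mult.commute)
  qed
  ultimately show thesis using that \<open>\<delta> \<noteq> 0\<close> by blast
qed

lemma normal_line_scaleR:
  assumes "\<nu> \<noteq> 0" "M s = \<nu> *\<^sub>R N s"
  shows "normal_line c M s = normal_line c N s"
proof -
  have "normal_line c M s = (\<lambda>r. c s + r *\<^sub>R N s) ` range (\<lambda>r. r * \<nu>)"
    unfolding normal_line_def image_image by (simp add: assms(2))
  moreover have "surj (\<lambda>r. r * \<nu>)"
    using assms(1) by (intro surjI[of _ "\<lambda>r. r / \<nu>"]) simp
  ultimately show ?thesis by (simp add: normal_line_def)
qed

text \<open>The curve determines \<open>T\<close>, and the derivative of \<open>T\<close> determines
  \<open>N\<close> up to a nonzero factor. This transfers the frame hidden in
  \<open>bertrand_curve\<close> to a given one.\<close>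

lemma frenet_normal_line_unique:
  assumes I: "is_interval I" "interior I \<noteq> {}"
    and fr: "frenet_frame I c T N B \<kappa> \<tau>" and fr': "frenet_frame I c T' N' B' \<kappa>' \<tau>'"
    and \<kappa>: "\<forall>s\<in>I. \<kappa> s \<noteq> 0" and \<kappa>': "\<forall>s\<in>I. \<kappa>' s \<noteq> 0" and s: "s \<in> I"
  shows "normal_line c N s = normal_line c N' s"
proof -
  note uniq = has_vector_derivative_unique_interval[OF I]
  have "T r = T' r" if "r \<in> I" for r
    using fr fr' that uniq[OF that, of c "T r" "T' r"] by (auto simp: frenet_frame_speed_def)
  then have "(T has_vector_derivative \<kappa>' s *\<^sub>R N' s) (at s within I)"
    using fr' s by (intro has_vector_derivative_transform[OF s, of T T'])
      (auto simp: frenet_frame_speed_def)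
  then have "\<kappa> s *\<^sub>R N s = \<kappa>' s *\<^sub>R N' s"
    using fr s uniq[OF s] by (auto simp: frenet_frame_speed_def)
  then have "N s = (inverse (\<kappa> s) * \<kappa>' s) *\<^sub>R N' s"
    using \<kappa> s by (metis scaleR_scaleR left_inverse scaleR_one)
  moreover have "inverse (\<kappa> s) * \<kappa>' s \<noteq> 0" using \<kappa> \<kappa>' s by simp
  ultimately show ?thesis using normal_line_scaleR by blast
qed

text \<open>For \<open>q \<noteq> 0\<close> the mate relation is divided by \<open>q\<close>. For
  \<open>q = 0\<close> the torsion vanishes, so by \<open>imp\<close> the curvature is a constant
  \<open>k\<close>, and \<open>1 / k\<close> serves as \<open>x\<close>.\<close>

lemma affine_relation_if_bertrand:
  assumes I: "is_interval I" "interior I \<noteq> {}"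
    and fr: "frenet_frame I c T N B \<kappa> \<tau>" and \<kappa>: "\<forall>s\<in>I. \<kappa> s \<noteq> 0"
    and imp: "\<tau> constant_on I \<longrightarrow> \<kappa> constant_on I"
    and bc: "bertrand_curve I c"
  obtains x y where "\<And>s. s \<in> I \<Longrightarrow> x * \<kappa> s + y * \<tau> s = 1"
proof -
  obtain T0 N0 B0 \<kappa>0 \<tau>0 b v T' N' B' k l where
    fr0: "frenet_frame I c T0 N0 B0 \<kappa>0 \<tau>0" "\<forall>s\<in>I. \<kappa>0 s \<noteq> 0"
    and fr': "frenet_frame_speed I b v T' N' B' k l" and ne: "\<exists>s\<in>I. b s \<noteq> c s"
    and lines0: "\<forall>s\<in>I. normal_line b N' s = normal_line c N0 s"
    using bc unfolding bertrand_curve_def by blast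
  have lines: "normal_line b N' s = normal_line c N s" if "s \<in> I" for s
    using lines0 frenet_normal_line_unique[OF I fr fr0(1) \<kappa> fr0(2) that] that by simp
  obtain \<delta> p q where "\<delta> \<noteq> 0" and pq: "p \<noteq> 0 \<or> q \<noteq> 0"
    and rel: "\<And>s. s \<in> I \<Longrightarrow> q * (1 - \<delta> * \<kappa> s) = p * (\<delta> * \<tau> s)"
    using bertrand_mate_relation[OF I fr fr' lines ne] by blast
  show thesis
  proof (cases "q = 0")
    case True
    then have "\<tau> s = 0" if "s \<in> I" for s using rel[OF that] pq \<open>\<delta> \<noteq> 0\<close> by simp
    then have "\<tau> constant_on I" unfolding constant_on_def by blast
    then obtain k where k: "\<And>s. s \<in> I \<Longrightarrow> \<kappa> s = k" using imp unfolding constant_on_def by blast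
    show thesis by (rule that[of "1 / k" 0]) (use k \<kappa> in force)
  next
    case False
    show thesis
      by (rule that[of \<delta> "p * \<delta> / q"]) (use rel False in \<open>auto simp: field_simps\<close>)
  qed
qed

section \<open>Transfer to the RM mate\<close>

theorem theorem5p3:
  fixes I :: "real set" and \<alpha> \<gamma> t n1 n2 :: "real \<Rightarrow> real^3" and \<kappa>1 \<kappa>2 :: "real \<Rightarrow> real"
  assumes "is_interval I" and "interior I \<noteq> {}"
    and "rm_frame I \<alpha> t n1 n2 \<kappa>1 \<kappa>2"
    and "\<forall>s\<in>I. (\<gamma> has_vector_derivative n1 s) (at s within I)"
    and "\<forall>s\<in>I. \<kappa>1 s \<noteq> 0"
  shows "((\<kappa>2 constant_on I \<longrightarrow> \<kappa>1 constant_on I) \<longrightarrow>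
            (spherical_curve I \<alpha> \<longleftrightarrow> bertrand_curve I \<gamma>))
       \<and> (plane_curve I \<alpha> \<longleftrightarrow> generalized_helix I \<gamma>)"
proof (intro conjI impI)
  show "plane_curve I \<alpha> \<longleftrightarrow> generalized_helix I \<gamma>"
    by (rule plane_iff_helix[OF assms])
  \<comment> \<open>Without this both directions can fail when \<open>\<kappa>1\<close> is not
    constant: for \<open>\<kappa>2 = 0\<close> the mate is a plane curve, hence Bertrand, but
    \<open>\<alpha>\<close> is not spherical; for a nonzero constant \<open>\<kappa>2\<close> it is
    the other way round.\<close>
  assume "\<kappa>2 constant_on I \<longrightarrow> \<kappa>1 constant_on I"
  moreover have "\<kappa>2 constant_on I" if "(\<lambda>s. - \<kappa>2 s) constant_on I"
    using that unfolding constant_on_def by (metis minus_minus)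
  ultimately have imp: "(\<lambda>s. - \<kappa>2 s) constant_on I \<longrightarrow> \<kappa>1 constant_on I" by blast
  note fr = rm_mate_frenet_frame[OF assms(3,4)]
  show "spherical_curve I \<alpha> \<longleftrightarrow> bertrand_curve I \<gamma>"
    unfolding spherical_curve_iff[OF assms(1-3)]
  proof
    assume "\<exists>x y. \<forall>s\<in>I. 1 + x * \<kappa>1 s + y * \<kappa>2 s = 0"
    then obtain x y where xy: "\<And>s. s \<in> I \<Longrightarrow> 1 + x * \<kappa>1 s + y * \<kappa>2 s = 0" by blast
    \<comment> \<open>Only \<open>x\<close> changes sign, since the torsion
      \<open>- \<kappa>2\<close> of the mate absorbs the sign at \<open>y\<close>.\<close>
    have "(- x) * \<kappa>1 s + y * - \<kappa>2 s = 1" if "s \<in> I" for s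
      using xy[OF that] by (simp add: algebra_simps)
    then show "bertrand_curve I \<gamma>"
      by (rule bertrand_if_affine_relation[OF assms(1,2) fr assms(5) imp])
  next
    assume "bertrand_curve I \<gamma>"
    then obtain x y where xy: "\<And>s. s \<in> I \<Longrightarrow> x * \<kappa>1 s + y * - \<kappa>2 s = 1"
      using affine_relation_if_bertrand[OF assms(1,2) fr assms(5) imp] by blast
    have "1 + (- x) * \<kappa>1 s + y * \<kappa>2 s = 0" if "s \<in> I" for s
      using xy[OF that] by (simp add: algebra_simps)
    then show "\<exists>x y. \<forall>s\<in>I. 1 + x * \<kappa>1 s + y * \<kappa>2 s = 0" by blast
  qed
qed

end
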